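(* The linear operator $j:\mathbb{R}^3\to\mathbb{R}^3$, $j(x,y,z)=(-z,x,y)$, reflects any point of $\mathbb{R}^3$ with respect to the plane $M$ and subsequently rotates its image by $\frac{\pi}{3}$ radians around the axis $L$. That is, $j=\rho\circ\sigma$, where $\sigma$ is the orthogonal reflection of $\mathbb{R}^3$ through the plane $M$ and $\rho$ is a rotation by angle $\frac{\pi}{3}$ about the line $L$ (for a suitable orientation of the axis).
   Context: $\mathbb{R}^3$ is Euclidean space with its standard basis $e_1,e_2,e_3$; the operator $j$ is the linear map with $e_1\mapsto e_2\mapsto e_3\mapsto -e_1$. The line $L$ and the plane $M$ are $$L=\{(x,y,z)\in\mathbb{R}^3: x=-y=z\},\qquad M=\{(x,y,z)\in\mathbb{R}^3: x-y+z=0\}.$$ The line $L$ is the line through the origin perpendicular to $M$. *)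

theory Defs
  imports "HOL-Analysis.Analysis"
begin

unbundle cross3_syntax

definition j :: "real^3 \<Rightarrow> real^3" where
  "j v = vector [- (v $ 3), v $ 1, v $ 2]"

definition L :: "(real^3) set" where
  "L = {v. v $ 1 = - (v $ 2) \<and> - (v $ 2) = v $ 3}"

definition M :: "(real^3) set" where
  "M = {v. v $ 1 - v $ 2 + v $ 3 = 0}"

definition orthogonal_reflection_through :: "(real^3) set \<Rightarrow> (real^3 \<Rightarrow> real^3) \<Rightarrow> bool" where
  "orthogonal_reflection_through P s \<longleftrightarrow>
     linear s \<and> (\<forall>v\<in>P. s v = v) \<and> (\<forall>v\<in>orthogonal_comp P. s v = - v)"

(* The unit vector u orients the axis A. For v perpendicular to u, the pair (v, u \<times> v) is a
   right-angled frame of the plane perpendicular to the axis, positively oriented as seen from u,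
   and the rotation turns v through the angle t in that plane. Both u and -u are allowed, so the
   sense of rotation about the unoriented line A is left open. *)
definition rotation_about :: "(real^3) set \<Rightarrow> real \<Rightarrow> (real^3 \<Rightarrow> real^3) \<Rightarrow> bool" where
  "rotation_about A t r \<longleftrightarrow>
     linear r \<and>
     (\<exists>u. norm u = 1 \<and> A = span {u} \<and> r u = u \<and>
          (\<forall>v. orthogonal u v \<longrightarrow> r v = cos t *\<^sub>R v + sin t *\<^sub>R (u \<times> v)))"

lemma linear_j: "linear j"
  by (rule linearI) (simp_all add: j_def vec_eq_iff forall_3)

lemma j_axis: "j (axis 1 1) = axis 2 1" "j (axis 2 1) = axis 3 1" "j (axis 3 1) = - axis 1 1"
  by (simp_all add: j_def vec_eq_iff forall_3 axis_def)

end

theory Submission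
  imports Defs
begin

text \<open>A reflection is its own inverse (\<open>reflect_M_involution\<close>), so the only
  candidate for the rotation is \<open>j \<circ> reflect_M\<close>. Both factors send
  \<open>normal_M\<close> to its negative, so the composite fixes the axis; on \<open>M\<close> the
  reflection is the identity and the composite is \<open>j\<close>, already a rotation there
  (\<open>rotation_about_L\<close>).\<close>

text \<open>The vector n = (1, -1, 1) spans L, is normal to M, and satisfies j n = - n, while on M the map
  j is v \<mapsto> (v + n \<times> v) / 2, the rotation by pi / 3 about n / sqrt 3.\<close>

definition normal_M :: "real^3" where
  "normal_M = vector [1, -1, 1]"

text \<open>Householder's formula; the denominator 3 is the squared norm of
  \<open>normal_M\<close>.\<close>

definition reflect_M :: "real^3 \<Rightarrow> real^3" where
  "reflect_M v = v - (2 / 3 * (normal_M \<bullet> v)) *\<^sub>R normal_M"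

lemma normal_M_nth [simp]: "normal_M $ 1 = 1" "normal_M $ 2 = -1" "normal_M $ 3 = 1"
  by (simp_all add: normal_M_def)

lemma j_nth [simp]: "j v $ 1 = - (v $ 3)" "j v $ 2 = v $ 1" "j v $ 3 = v $ 2"
  by (simp_all add: j_def)

lemma inner_normal_M: "normal_M \<bullet> v = v $ 1 - v $ 2 + v $ 3"
  by (simp add: inner_vec_def sum_3)

lemma norm_normal_M: "norm normal_M = sqrt 3"
  by (simp add: norm_eq_sqrt_inner inner_normal_M)

lemma L_eq_span: "L = span {normal_M}"
proof -
  have "v \<in> L \<longleftrightarrow> (\<exists>k. v = k *\<^sub>R normal_M)" for v
    by (auto simp: L_def vec_eq_iff forall_3)
  then show ?thesis
    by (auto simp: span_singleton)
qed

lemma orthogonal_comp_M: "orthogonal_comp M = L"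
proof
  show "orthogonal_comp M \<subseteq> L"
  proof
    fix v assume v: "v \<in> orthogonal_comp M"
    \<comment> \<open>A basis of \<open>M\<close> chosen so that orthogonality to its two vectors
      gives exactly the two equations defining \<open>L\<close>.\<close>
    have "vector [1, 1, 0] \<in> M" "vector [0, 1, 1] \<in> M"
      by (simp_all add: M_def)
    with v have "orthogonal v (vector [1, 1, 0])" "orthogonal v (vector [0, 1, 1])"
      by (auto simp: orthogonal_comp_def orthogonal_commute)
    then show "v \<in> L"
      by (simp add: L_def orthogonal_def inner_vec_def sum_3)
  qed
  show "L \<subseteq> orthogonal_comp M"
    by (auto simp: L_eq_span span_singleton orthogonal_comp_def orthogonal_def M_def
        inner_normal_M inner_commute[of _ normal_M])
qed

lemma orthogonal_reflection_through_M: "orthogonal_reflection_through M reflect_M"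
  unfolding orthogonal_reflection_through_def
proof (intro conjI ballI)
  show "linear reflect_M"
    by (rule linearI) (simp_all add: reflect_M_def inner_normal_M vec_eq_iff forall_3 field_simps)
  show "reflect_M v = v" if "v \<in> M" for v
    using that by (simp add: reflect_M_def inner_normal_M M_def)
  show "reflect_M v = - v" if "v \<in> orthogonal_comp M" for v
    using that by (auto simp: orthogonal_comp_M L_def reflect_M_def inner_normal_M
        vec_eq_iff forall_3)
qed

lemma reflect_M_involution: "reflect_M (reflect_M v) = v"
  by (simp add: reflect_M_def inner_normal_M vec_eq_iff forall_3 field_simps)

lemma rotation_about_L: "rotation_about L (pi / 3) (j \<circ> reflect_M)"
  unfolding rotation_about_def
proof (intro conjI exI allI impI)
  \<comment> \<open>The sign fixes the orientation: seen from the opposite unit vector the angle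
    would be -pi/3.\<close>
  let ?u = "(1 / sqrt 3) *\<^sub>R normal_M"
  show "linear (j \<circ> reflect_M)"
    using orthogonal_reflection_through_M linear_j
    by (auto simp: orthogonal_reflection_through_def intro: linear_compose)
  show "norm ?u = 1"
    by (simp add: norm_normal_M)
  show "L = span {?u}"
    using span_image_scale[of "{normal_M}" "\<lambda>_. 1 / sqrt 3"] by (simp add: L_eq_span)
  show "(j \<circ> reflect_M) ?u = ?u"
    by (simp add: reflect_M_def inner_normal_M vec_eq_iff forall_3 field_simps)
  show "(j \<circ> reflect_M) v = cos (pi / 3) *\<^sub>R v + sin (pi / 3) *\<^sub>R (?u \<times> v)"
    if "orthogonal ?u v" for v
  proof -
    from that have v: "normal_M \<bullet> v = 0"
      by (simp add: orthogonal_def)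
    \<comment> \<open>Eliminating one coordinate makes the goal a coordinatewise identity: cos(pi/3)
      and sin(pi/3) / sqrt 3 both equal 1/2.\<close>
    then have "v $ 2 = v $ 1 + v $ 3"
      by (simp add: inner_normal_M)
    with v show ?thesis
      by (simp add: reflect_M_def cos_60 sin_60 cross_mult_left cross3_simps
          vec_eq_iff forall_3 field_simps)
  qed
qed

theorem theorem1p1:
  shows "\<exists>\<sigma> \<rho>. orthogonal_reflection_through M \<sigma> \<and> rotation_about L (pi / 3) \<rho> \<and> j = \<rho> \<circ> \<sigma>"
proof (intro exI conjI)
  show "j = (j \<circ> reflect_M) \<circ> reflect_M"
    by (simp add: fun_eq_iff reflect_M_involution)
qed (fact orthogonal_reflection_through_M rotation_about_L)+

end
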